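(* Let $D\subset\mathbb{R}^2$ be the set of all pairs $(m,\theta)$, with $m>0$ and $0<\theta<\pi/2$, such that $$\inf\{\mathcal{A}_D-\mathcal{A}_E:\ l>r_0>0,\ l>c>0\}<0,$$ where $$\mathcal{A}_D-\mathcal{A}_E=l^2\theta^2\Big(1+\frac2m\Big)+c^2+\frac1{12}(3r_0^2+c^2+3cr_0)(\pi-2\theta)^2+\frac{m^2}{m(l-r_0)+2l}+\frac{m}{\sqrt{(r_0+c)^2+l^2(1+2/m)^2}}+\frac1{2c}\log\Big(1+\frac{c}{r_0}\Big)-\frac32\Big[\big(\tfrac12+2m\big)^2\big(\tfrac{\pi}{2}-\theta\big)\Big]^{1/3}.$$ Then $D$ is a non-empty open subset of $\mathbb{R}^2$.
   Context: The infimum is over the real parameters $l,r_0,c$, for fixed $(m,\theta)$. Origin of the expression: in the planar three-body problem with masses $m_1=m_2=1$, $m_3=m$, $\mathcal{A}_D$ stands for the Lagrangian action over $0\le t\le1$ of the path $x_1(t)=le^{i\theta t}+(r_0+ct)e^{i(\theta-\pi/2)t}$, $x_2(t)=le^{i\theta t}-(r_0+ct)e^{i(\theta-\pi/2)t}$, $x_3(t)=-\frac{2l}{m}e^{i\theta t}$, with the potential terms for the pairs $\{1,3\}$ and $\{2,3\}$ replaced by upper estimates, and $\mathcal{A}_E=\frac32[(\frac12+2m)^2(\frac{\pi}{2}-\theta)]^{1/3}$ is the value given for the action of the Euler orbit with $x_3$ at the center of mass. Only the displayed expression is needed for the claim. *)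

theory Defs
  imports "HOL-Analysis.Analysis"
begin

definition action_D :: "real \<Rightarrow> real \<Rightarrow> real \<Rightarrow> real \<Rightarrow> real \<Rightarrow> real" where
  "action_D m \<theta> l r\<^sub>0 c =
     l\<^sup>2 * \<theta>\<^sup>2 * (1 + 2 / m) + c\<^sup>2
     + 1 / 12 * (3 * r\<^sub>0\<^sup>2 + c\<^sup>2 + 3 * c * r\<^sub>0) * (pi - 2 * \<theta>)\<^sup>2
     + m\<^sup>2 / (m * (l - r\<^sub>0) + 2 * l)
     + m / sqrt ((r\<^sub>0 + c)\<^sup>2 + l\<^sup>2 * (1 + 2 / m)\<^sup>2)
     + 1 / (2 * c) * ln (1 + c / r\<^sub>0)"

definition action_E :: "real \<Rightarrow> real \<Rightarrow> real" where
  "action_E m \<theta> = 3 / 2 * root 3 ((1 / 2 + 2 * m)\<^sup>2 * (pi / 2 - \<theta>))"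

(* For fixed m > 0 and 0 < \<theta> < pi/2 the parameter region is nonempty and the difference
   is bounded below there by - action_E m \<theta>, so the infimum in the reals is the true infimum. *)
definition region_D :: "(real \<times> real) set" where
  "region_D = {(m, \<theta>). 0 < m \<and> 0 < \<theta> \<and> \<theta> < pi / 2 \<and>
     Inf {action_D m \<theta> l r\<^sub>0 c - action_E m \<theta> | l r\<^sub>0 c.
            l > r\<^sub>0 \<and> r\<^sub>0 > 0 \<and> l > c \<and> c > 0} < 0}"

end

theory Submission
  imports Defs
begin

text \<open>
  The infimum is negative iff some admissible (l, r, c) makes the difference negative, so the
  region is a union of sets cut out by strict inequalities between continuous functions of
  (m, \<theta>). It contains (2, 1/100): with m fixed, a small \<theta> makes the rotation energy of a
  large l negligible while the terms involving the third body decay like 1/l.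
\<close>

lemma action_D_nonneg:
  assumes "m > 0" "l > r" "r > 0" "c > 0"
  shows "action_D m \<theta> l r c \<ge> 0"
  unfolding action_D_def using assms
  by (intro add_nonneg_nonneg mult_nonneg_nonneg divide_nonneg_nonneg) auto

lemma mem_region_D_iff:
  "(m, \<theta>) \<in> region_D \<longleftrightarrow> 0 < m \<and> 0 < \<theta> \<and> \<theta> < pi / 2 \<and>
     (\<exists>l r c. l > r \<and> r > 0 \<and> l > c \<and> c > 0 \<and> action_D m \<theta> l r c < action_E m \<theta>)"
proof (cases "0 < m")
  case True
  let ?A = "{action_D m \<theta> l r c - action_E m \<theta> | l r c. l > r \<and> r > 0 \<and> l > c \<and> c > 0}"
  \<comment> \<open>A real \<open>Inf\<close> can be compared with 0 through its elements once the
    set is nonempty and bounded below. The point l = 2, r = c = 1 gives the former, nonnegativity of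
    \<open>action_D\<close> the latter.\<close>
  have "(2::real) > 1 \<and> (1::real) > 0 \<and> (2::real) > 1 \<and> (1::real) > 0"
    by simp
  then have "?A \<noteq> {}"
    by blast
  moreover have "bdd_below ?A"
  proof (rule bdd_belowI)
    fix x assume "x \<in> ?A"
    then obtain l r c where "x = action_D m \<theta> l r c - action_E m \<theta>" "l > r" "r > 0" "c > 0"
      by blast
    then show "- action_E m \<theta> \<le> x"
      using action_D_nonneg[OF True, of r l c \<theta>] by simp
  qed
  ultimately have "Inf ?A < 0 \<longleftrightarrow> (\<exists>x\<in>?A. x < 0)"
    by (rule cInf_less_iff)
  also have "\<dots> \<longleftrightarrow>
      (\<exists>l r c. l > r \<and> r > 0 \<and> l > c \<and> c > 0 \<and> action_D m \<theta> l r c - action_E m \<theta> < 0)"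
    by blast
  finally show ?thesis
    unfolding region_D_def by simp
qed (simp add: region_D_def)

text \<open>With l, r, c frozen, only division can break continuity. The domain keeps m positive;
  the other two denominators stay nonzero because l > r > 0 and r + c > 0.\<close>

lemma continuous_on_action_D:
  assumes "l > r" "r > 0" "c > 0"
  shows "continuous_on ({0<..} \<times> UNIV) (\<lambda>x. action_D (fst x) (snd x) l r c)"
proof -
  have "m * (l - r) + 2 * l \<noteq> 0" if "m > 0" for m
  proof -
    have "m * (l - r) > 0"
      using that assms by simp
    then show ?thesis
      using assms by linarith
  qed
  moreover have "(r + c)\<^sup>2 + l\<^sup>2 * (1 + 2 / m)\<^sup>2 \<noteq> 0" for m
    using assms by (smt (verit) zero_less_power mult_nonneg_nonneg zero_le_power2)
  ultimately show ?thesis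
    unfolding action_D_def by (intro continuous_intros) auto
qed

text \<open>\<open>root 3\<close> is continuous on the whole real line, negative arguments included,
  so \<open>S\<close> can be arbitrary.\<close>

lemma continuous_on_action_E: "continuous_on S (\<lambda>x. action_E (fst x) (snd x))"
  unfolding action_E_def by (intro continuous_intros)

lemma open_region_D: "open region_D"
proof -
  \<comment> \<open>Since \<open>B\<close> is open, preimages that are open relative to
    \<open>B\<close> are open in the plane.\<close>
  define B where "B = ({0<..} \<times> {0<..<pi / 2} :: (real \<times> real) set)"
  define U where
    "U l r c = {x \<in> B. action_D (fst x) (snd x) l r c - action_E (fst x) (snd x) < 0}" for l r c
  have "open (U l r c)" if "l > r" "r > 0" "c > 0" for l r c
  proof -
    have "continuous_on B (\<lambda>x. action_D (fst x) (snd x) l r c - action_E (fst x) (snd x))"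
      by (intro continuous_on_diff continuous_on_action_E
          continuous_on_subset[OF continuous_on_action_D[OF that]]) (auto simp: B_def)
    moreover have "open B"
      unfolding B_def by (intro open_Times) auto
    ultimately have "open (B \<inter> (\<lambda>x. action_D (fst x) (snd x) l r c
        - action_E (fst x) (snd x)) -` {..<0})"
      by (intro continuous_open_preimage) auto
    also have "\<dots> = U l r c"
      by (auto simp: U_def)
    finally show ?thesis .
  qed
  \<comment> \<open>The existential quantifier over (l, r, c) turns into a union of open
    sets.\<close>
  then have "open (\<Union>(l, r, c) \<in> {(l, r, c). l > r \<and> r > 0 \<and> l > c \<and> c > 0}. U l r c)"
    by (intro open_UN) auto
  also have "\<dots> = region_D"
    by (auto simp: U_def B_def mem_region_D_iff; blast)
  finally show ?thesis .
qed

lemma two_hundredth_mem_region_D: "(2, 1 / 100) \<in> region_D"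
proof -
  have pi: "3 < pi" "pi < 4"
    using pi_gt3 pi_less_4 by simp_all
  \<comment> \<open>Three crude bounds cover the irrational quantities at l = 10, r = c = 1/2. This
    choice makes the logarithmic term exactly ln 2 and the square root sqrt 401; the third bound is
    for twice the term 2 / sqrt 401.\<close>
  have "(pi - 1 / 50)\<^sup>2 \<le> 4\<^sup>2"
    using pi by (intro power_mono) auto
  then have "(pi - 1 / 50)\<^sup>2 \<le> 16"
    by simp
  moreover have "ln (2 :: real) \<le> 1"
    using ln_add_one_self_le_self[of 1] by simp
  moreover have "4 / sqrt 401 \<le> 1 / 5"
  proof -
    have "20 \<le> sqrt 401"
      by (rule real_le_rsqrt) simp
    then show ?thesis
      by (simp add: field_simps)
  qed
  \<comment> \<open>The summands are at most 0.02, 0.25, 7/3, 4/39, 0.1 and 1, in total below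
    3.81.\<close>
  ultimately have "action_D 2 (1 / 100) 10 (1 / 2) (1 / 2) < 9 / 2"
    unfolding action_D_def by (simp (no_asm) add: power_divide)
  also have "9 / 2 \<le> action_E 2 (1 / 100)"
  proof -
    \<comment> \<open>From pi > 3 the radicand exceeds 81/4 * 1.49 > 30, hence 27, so
      \<open>action_E\<close> is at least 3/2 * 3.\<close>
    have "3 = root 3 (3 ^ 3)"
      by (rule real_root_power_cancel[symmetric]) auto
    also have "\<dots> \<le> root 3 ((1 / 2 + 2 * 2)\<^sup>2 * (pi / 2 - 1 / 100))"
      using pi by (intro real_root_le_mono) (simp_all add: power2_eq_square)
    finally show ?thesis
      unfolding action_E_def by simp
  qed
  finally have "action_D 2 (1 / 100) 10 (1 / 2) (1 / 2) < action_E 2 (1 / 100)" .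
  moreover have "(10::real) > 1 / 2" "(1 / 2 :: real) > 0"
    by simp_all
  moreover have "1 / 100 < pi / 2"
    using pi by simp
  ultimately show ?thesis
    unfolding mem_region_D_iff by (metis zero_less_numeral zero_less_divide_1_iff)
qed

theorem proposition7p6:
  shows "region_D \<noteq> {} \<and> open region_D"
  using two_hundredth_mem_region_D open_region_D by blast

end
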